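(* Let $d\ge 1$. The affine span, in $\mathbb{R}^{d+1}$, of the set of $\alpha$-vectors $\alpha(\Delta)=(\alpha_0(\Delta),\ldots,\alpha_d(\Delta))$ of all Euclidean $d$-simplices $\Delta$ has dimension $\left\lfloor\frac{d-1}{2}\right\rfloor$.
   Context: For a convex $d$-polytope $P\subset\mathbb{R}^d$ (with $d$-dimensional affine span) and a nonempty face $F\subseteq P$ (including $F=P$), the interior angle at $F$ is $\alpha(F,P)=\mathrm{vol}(S_\varepsilon(x)\cap P)/\mathrm{vol}(S_\varepsilon(x))$, where $x$ is a point in the relative interior of $F$, $S_\varepsilon(x)$ is the $(d-1)$-sphere of radius $\varepsilon$ centered at $x$, and $\varepsilon>0$ is small enough that the sphere meets only faces of $P$ containing $F$. The angle sums are $\alpha_i(P)=\sum_{F} \alpha(F,P)$, the sum over all $i$-dimensional faces $F$ of $P$, for $0\le i\le d$; thus $\alpha_d(P)=1$. The $\alpha$-vector is $\alpha(P)=(\alpha_0(P),\ldots,\alpha_d(P))$. *)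

theory Defs
  imports "HOL-Analysis.Analysis"
begin

text \<open>
  The surface measure of a subset \<open>A\<close> of the sphere \<open>S\<^sub>e(x)\<close> in a space of dimension \<open>n\<close>,
  given as usual by the Lebesgue measure of the cone over \<open>A\<close> with apex \<open>x\<close>: that cone has
  volume \<open>(e / n)\<close> times the surface measure of \<open>A\<close>. For \<open>n = 1\<close> this counts points.
\<close>
definition sphere_vol :: "'a::euclidean_space \<Rightarrow> real \<Rightarrow> 'a set \<Rightarrow> real" where
  "sphere_vol x e A =
     real DIM('a) / e * measure lebesgue {x + t *\<^sub>R (y - x) | t y. t \<in> {0..1} \<and> y \<in> A}"

text \<open>
  The condition is imposed on all radii up to \<open>e\<close>, which is what \<^emph>\<open>small enough\<close> means:
  a single sphere so large that it misses \<open>P\<close> altogether would satisfy it vacuously.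
\<close>
definition admissible_sphere :: "'a::euclidean_space set \<Rightarrow> 'a set \<Rightarrow> 'a \<Rightarrow> real \<Rightarrow> bool" where
  "admissible_sphere F P x e \<longleftrightarrow>
     x \<in> rel_interior F \<and> e > 0 \<and>
     (\<forall>r G. 0 < r \<and> r \<le> e \<and> G face_of P \<and> sphere x r \<inter> G \<noteq> {} \<longrightarrow> F \<subseteq> G)"

text \<open>
  For a nonempty face \<open>F\<close> of a full-dimensional polytope \<open>P\<close> admissible spheres exist, and
  the ratio is the same for all of them.
\<close>
definition interior_angle :: "'a::euclidean_space set \<Rightarrow> 'a set \<Rightarrow> real" where
  "interior_angle F P =
     (THE a. \<exists>x e. admissible_sphere F P x e \<and>
        a = sphere_vol x e (sphere x e \<inter> P) / sphere_vol x e (sphere x e))"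

definition angle_sum :: "nat \<Rightarrow> 'a::euclidean_space set \<Rightarrow> real" where
  "angle_sum i P = (\<Sum>F | F face_of P \<and> aff_dim F = int i. interior_angle F P)"

text \<open>
  The vector \<open>(\<alpha>\<^sub>0(P), \<dots>, \<alpha>\<^sub>d(P))\<close>, its coordinates being indexed by a finite type that
  is numbered by \<open>0, \<dots>, d\<close> through \<open>idx\<close>.
\<close>
definition alpha_vector :: "('m::finite \<Rightarrow> nat) \<Rightarrow> 'a::euclidean_space set \<Rightarrow> real ^ 'm" where
  "alpha_vector idx P = (\<chi> j. angle_sum (idx j) P)"

end

theory Submission
  imports Defs
begin

text \<open>
  Let \<open>a\<^sub>0, \<dots>, a\<^sub>d\<close> be the inner facet normals of a simplex, so that a positive combination of them
  vanishes. The angle at the face with vertex set \<open>J\<close> is the probability that \<open>a\<^sub>i \<bullet> u \<ge> 0\<close> for all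
  \<open>i \<notin> J\<close>, where \<open>u\<close> is uniform on the unit ball. Hence the angle sums are the binomial
  moments of the random number \<open>N\<close> of indices with \<open>a\<^sub>i \<bullet> u \<ge> 0\<close>. Almost surely \<open>1 \<le> N \<le> d\<close>, and
  \<open>N\<close> has the same distribution as \<open>d + 1 - N\<close> because \<open>u\<close> and \<open>- u\<close> do. So every
  \<open>\<alpha>\<close>-vector is a convex combination of the vectors \<open>q\<^sub>k\<close> of binomial moments of the uniform
  distribution on \<open>{k, d + 1 - k}\<close>, and the distinct ones among these, \<open>1 \<le> k \<le> (d + 1) div 2\<close>,
  are linearly independent. Conversely, each \<open>q\<^sub>k\<close> is a limit of \<open>\<alpha>\<close>-vectors: take normals that
  are nearly multiples \<open>c\<^sub>i w\<close> of one vector \<open>w\<close>, with exactly \<open>k\<close> of the \<open>c\<^sub>i\<close> positive.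
\<close>

subsection \<open>Faces and angles of a simplex in barycentric coordinates\<close>

text \<open>\<open>a i \<bullet> x + b i\<close> is the barycentric coordinate of \<open>x\<close>
  at the vertex \<open>p i\<close>, so \<open>a i\<close> is an inner normal of the opposite facet.
  Vertices and normals share the index set \<open>I\<close>, so that a frame can come from a given
  simplex as well as from prescribed normals.\<close>

locale barycentric_frame =
  fixes I :: "'i set" and p a :: "'i \<Rightarrow> 'a::euclidean_space" and b :: "'i \<Rightarrow> real"
  assumes finite_I: "finite I" and card_I: "card I = DIM('a) + 1"
    and dual: "\<And>i j. \<lbrakk>i \<in> I; j \<in> I\<rbrakk> \<Longrightarrow> a i \<bullet> p j + b i = (if i = j then 1 else 0)"
begin

lemma inj_p: "inj_on p I"
proof (rule inj_onI)
  fix i j assume "i \<in> I" "j \<in> I" "p i = p j"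
  then show "i = j"
    using dual[of i i] dual[of i j] by (auto split: if_splits)
qed

text \<open>By \<open>dual\<close>, each affine function reads off one coefficient.
  \<open>sum c J\<close> is left free: the value 0 serves affine independence, the value 1 the
  coordinates of points.\<close>

lemma eval_combination:
  assumes J: "J \<subseteq> I" and i: "i \<in> I"
  shows "a i \<bullet> (\<Sum>j\<in>J. c j *\<^sub>R p j) + b i * sum c J = (if i \<in> J then c i else 0)"
proof -
  have fJ: "finite J" using J finite_I finite_subset by blast
  have "a i \<bullet> (\<Sum>j\<in>J. c j *\<^sub>R p j) + b i * sum c J = (\<Sum>j\<in>J. c j * (a i \<bullet> p j + b i))"
    by (simp add: inner_sum_right sum_distrib_left sum.distrib[symmetric] algebra_simps)
  also have "\<dots> = (\<Sum>j\<in>J. if i = j then c j else 0)"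
    using J i by (intro sum.cong refl) (auto simp: dual)
  finally show ?thesis using fJ by (simp add: sum.delta')
qed

lemma affine_independent: "\<not> affine_dependent (p ` I)"
proof
  assume "affine_dependent (p ` I)"
  then obtain U v where U: "sum U (p ` I) = 0" "v \<in> p ` I" "U v \<noteq> 0" "(\<Sum>v\<in>p ` I. U v *\<^sub>R v) = 0"
    using affine_dependent_explicit_finite[of "p ` I"] finite_I by blast
  then obtain i where i: "i \<in> I" "v = p i" by blast
  have "sum (U \<circ> p) I = 0" "(\<Sum>i\<in>I. (U \<circ> p) i *\<^sub>R p i) = 0"
    using U by (simp_all add: sum.reindex[OF inj_p])
  then show False
    using eval_combination[OF subset_refl i(1), of "U \<circ> p"] U i by simp
qed

lemma representation:
  shows "(\<Sum>i\<in>I. a i \<bullet> x + b i) = 1" and "(\<Sum>i\<in>I. (a i \<bullet> x + b i) *\<^sub>R p i) = x"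
proof -
  have "affine hull (p ` I) = UNIV"
    using affine_independent_span_eq[OF affine_independent] card_I inj_p by (simp add: card_image)
  then have "x \<in> affine hull (p ` I)" by simp
  then obtain U where U: "sum U (p ` I) = 1" "(\<Sum>v\<in>p ` I. U v *\<^sub>R v) = x"
    using finite_I by (auto simp: affine_hull_finite)
  define c where "c = U \<circ> p"
  have c: "sum c I = 1" "(\<Sum>i\<in>I. c i *\<^sub>R p i) = x"
    using U by (simp_all add: c_def sum.reindex[OF inj_p])
  have *: "a i \<bullet> x + b i = c i" if "i \<in> I" for i
    using eval_combination[OF subset_refl that, of c] that by (simp add: c)
  show "(\<Sum>i\<in>I. a i \<bullet> x + b i) = 1" "(\<Sum>i\<in>I. (a i \<bullet> x + b i) *\<^sub>R p i) = x"
    using c by (simp_all add: *)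
qed

text \<open>The coordinates add up to the constant 1, so their linear parts cancel.\<close>

lemma sum_normals: "(\<Sum>i\<in>I. a i \<bullet> x) = 0"
  using representation(1)[of x] representation(1)[of 0] by (simp add: sum.distrib)

lemma normal_nonzero: "i \<in> I \<Longrightarrow> a i \<noteq> 0"
proof
  assume i: "i \<in> I" and 0: "a i = 0"
  have "card (I - {i}) \<noteq> 0" using i card_I by simp
  then obtain j where "j \<in> I" "j \<noteq> i" by (metis Diff_iff card.empty equals0I singleton_iff)
  then show False using i 0 dual[of i i] dual[of i j] by simp
qed

text \<open>Coordinates are unique: \<open>only_if\<close> identifies the coefficients of any
  combination with them, and \<open>if_part\<close> uses them as coefficients. Only the sign
  condition distinguishes the hull from its relative interior.\<close>

lemma convex_hull_iff:
  assumes J: "J \<subseteq> I"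
  shows "x \<in> convex hull (p ` J) \<longleftrightarrow>
    (\<forall>i\<in>J. 0 \<le> a i \<bullet> x + b i) \<and> (\<forall>i\<in>I - J. a i \<bullet> x + b i = 0)" (is "?L \<longleftrightarrow> ?R")
    and rel_interior_iff: "x \<in> rel_interior (convex hull (p ` J)) \<longleftrightarrow>
    (\<forall>i\<in>J. 0 < a i \<bullet> x + b i) \<and> (\<forall>i\<in>I - J. a i \<bullet> x + b i = 0)" (is "?L' \<longleftrightarrow> ?R'")
proof -
  have fJ: "finite J" using J finite_I finite_subset by blast
  have inj: "inj_on p J" using inj_p J inj_on_subset by blast
  have ind: "\<not> affine_dependent (p ` J)"
    using affine_independent affine_dependent_subset J by blast
  have only_if: "(\<forall>i\<in>J. a i \<bullet> x + b i = U (p i)) \<and> (\<forall>i\<in>I - J. a i \<bullet> x + b i = 0)"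
    if U: "sum U (p ` J) = 1" "(\<Sum>v\<in>p ` J. U v *\<^sub>R v) = x" for U
  proof -
    have c: "sum (U \<circ> p) J = 1" "(\<Sum>i\<in>J. (U \<circ> p) i *\<^sub>R p i) = x"
      using U by (simp_all add: sum.reindex[OF inj])
    show ?thesis
      using eval_combination[OF J, of _ "U \<circ> p"] J unfolding c by auto
  qed
  have if_part: "sum U (p ` J) = 1 \<and> (\<Sum>v\<in>p ` J. U v *\<^sub>R v) = x"
    if 0: "\<forall>i\<in>I - J. a i \<bullet> x + b i = 0" and U: "U = (\<lambda>v. a (inv_into J p v) \<bullet> x + b (inv_into J p v))" for U
  proof -
    have "sum U (p ` J) = (\<Sum>i\<in>J. a i \<bullet> x + b i)"
      unfolding U by (simp add: sum.reindex[OF inj] inv_into_f_f[OF inj])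
    also have "\<dots> = (\<Sum>i\<in>I. a i \<bullet> x + b i)"
      using 0 by (intro sum.mono_neutral_left finite_I J) auto
    finally have 1: "sum U (p ` J) = 1" by (simp add: representation)
    have "(\<Sum>v\<in>p ` J. U v *\<^sub>R v) = (\<Sum>i\<in>J. (a i \<bullet> x + b i) *\<^sub>R p i)"
      unfolding U by (simp add: sum.reindex[OF inj] inv_into_f_f[OF inj])
    also have "\<dots> = (\<Sum>i\<in>I. (a i \<bullet> x + b i) *\<^sub>R p i)"
      using 0 by (intro sum.mono_neutral_left finite_I J) auto
    finally show ?thesis using 1 by (simp add: representation)
  qed
  show "?L \<longleftrightarrow> ?R"
  proof
    assume ?L
    then obtain U where "\<forall>v\<in>p ` J. 0 \<le> U v" "sum U (p ` J) = 1" "(\<Sum>v\<in>p ` J. U v *\<^sub>R v) = x"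
      using fJ by (auto simp: convex_hull_finite)
    with only_if show ?R by auto
  next
    assume R: ?R
    show ?L
      unfolding convex_hull_finite[OF finite_imageI[OF fJ]] mem_Collect_eq
      by (rule exI, rule conjI[OF _ if_part[OF _ refl]])
        (use R in \<open>auto simp: inv_into_f_f[OF inj]\<close>)
  qed
  show "?L' \<longleftrightarrow> ?R'"
  proof
    assume ?L'
    then obtain U where "\<forall>v\<in>p ` J. 0 < U v" "sum U (p ` J) = 1" "(\<Sum>v\<in>p ` J. U v *\<^sub>R v) = x"
      unfolding rel_interior_convex_hull_explicit[OF ind] by blast
    with only_if show ?R' by auto
  next
    assume R: ?R'
    show ?L'
      unfolding rel_interior_convex_hull_explicit[OF ind] mem_Collect_eq
      by (rule exI, rule conjI[OF _ if_part[OF _ refl]])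
        (use R in \<open>auto simp: inv_into_f_f[OF inj]\<close>)
  qed
qed

lemma face_iff: "G face_of convex hull (p ` I) \<longleftrightarrow> (\<exists>J\<subseteq>I. G = convex hull (p ` J))"
  unfolding face_of_convex_hull_affine_independent[OF affine_independent]
  by (metis subset_image_iff)

lemma p_in_convex_hull_iff:
  assumes "J \<subseteq> I" "i \<in> I"
  shows "p i \<in> convex hull (p ` J) \<longleftrightarrow> i \<in> J"
proof
  assume "p i \<in> convex hull (p ` J)"
  then show "i \<in> J"
    using convex_hull_iff(1)[OF assms(1)] dual[OF assms(2) assms(2)] assms(2) by force
qed (simp add: hull_inc)

lemma convex_hull_subset_iff:
  assumes "J \<subseteq> I" "K \<subseteq> I"
  shows "convex hull (p ` J) \<subseteq> convex hull (p ` K) \<longleftrightarrow> J \<subseteq> K"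
proof
  assume *: "convex hull (p ` J) \<subseteq> convex hull (p ` K)"
  show "J \<subseteq> K"
  proof
    fix i assume "i \<in> J"
    then have "p i \<in> convex hull (p ` K)" using * by (auto intro: hull_inc)
    then show "i \<in> K" using p_in_convex_hull_iff \<open>i \<in> J\<close> assms by blast
  qed
qed (intro hull_mono image_mono)

section \<open>Tangent cones and interior angles\<close>

text \<open>The tangent cone of the simplex at a relative interior point of the face spanned by
  \<open>J\<close>, moved to the origin: the facets through that face are those opposite to vertices
  outside \<open>J\<close>.\<close>

definition cone :: "'i set \<Rightarrow> 'a set" where
  "cone J = {u. \<forall>i\<in>I - J. 0 \<le> a i \<bullet> u}"

text \<open>A segment from \<open>x\<close> in a direction of the tangent cone can leave the simplex
  only through a facet opposite to a vertex in \<open>J\<close>. Such a facet does not contain the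
  face, so admissibility keeps the segment inside up to radius \<open>e\<close>.\<close>

lemma sphere_inter_simplex:
  assumes J: "J \<subseteq> I"
    and adm: "admissible_sphere (convex hull (p ` J)) (convex hull (p ` I)) x e"
    and y: "dist x y = e"
  shows "y \<in> convex hull (p ` I) \<longleftrightarrow> y - x \<in> cone J"
proof -
  define l where "l i = a i \<bullet> x + b i" for i
  have x: "\<And>i. i \<in> J \<Longrightarrow> 0 < l i" "\<And>i. i \<in> I - J \<Longrightarrow> l i = 0" and e: "e > 0"
    and meets: "\<And>r G. \<lbrakk>0 < r; r \<le> e; G face_of convex hull (p ` I); sphere x r \<inter> G \<noteq> {}\<rbrakk>
      \<Longrightarrow> convex hull (p ` J) \<subseteq> G"
    using adm unfolding admissible_sphere_def rel_interior_iff[OF J] l_def by auto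
  have ly: "a i \<bullet> (x + s *\<^sub>R (y - x)) + b i = l i + s * (a i \<bullet> (y - x))" for i s
    by (simp add: l_def algebra_simps)
  have ly1: "a i \<bullet> y + b i = l i + a i \<bullet> (y - x)" for i
    using ly[of i 1] by simp
  show ?thesis
  proof
    assume "y \<in> convex hull (p ` I)"
    then show "y - x \<in> cone J"
      unfolding cone_def convex_hull_iff[OF subset_refl] ly1 using x(2) by auto
  next
    assume yc: "y - x \<in> cone J"
    define K where "K = {i \<in> J. l i + a i \<bullet> (y - x) < 0}"
    have fK: "finite K" unfolding K_def using J finite_I finite_subset by fastforce
    have "K = {}"
    proof (rule ccontr)
      assume ne: "K \<noteq> {}"
      \<comment> \<open>Along the segment from \<open>x\<close> to \<open>y\<close>, the coordinate
        with index \<open>i\<close> in \<open>K\<close> vanishes at parameter \<open>f i\<close>.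
        The least of these parameters gives the exit point \<open>z\<close>.\<close>
      define f where "f i = l i / (- (a i \<bullet> (y - x)))" for i
      have neg: "a i \<bullet> (y - x) < 0" if "i \<in> K" for i
        using that x(1)[of i] by (auto simp: K_def)
      have f01: "0 < f i" "f i < 1" if "i \<in> K" for i
        using that x(1)[of i] neg[OF that] by (auto simp: K_def f_def field_simps)
      obtain i where i: "i \<in> K" and min: "\<And>j. j \<in> K \<Longrightarrow> f i \<le> f j"
        using fK ne by (metis (no_types, lifting) arg_min_if_finite(1) arg_min_least)
      define z where "z = x + f i *\<^sub>R (y - x)"
      have iJ: "i \<in> J" using i by (simp add: K_def)
      have lz: "a j \<bullet> z + b j = l j + f i * (a j \<bullet> (y - x))" for j
        unfolding z_def by (rule ly)
      have "0 \<le> a j \<bullet> z + b j" if "j \<in> I" for j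
      proof (cases "j \<in> K")
        case True
        have "f i * - (a j \<bullet> (y - x)) \<le> f j * - (a j \<bullet> (y - x))"
          using min[OF True] neg[OF True] by (intro mult_right_mono) auto
        also have "\<dots> = l j" using neg[OF True] by (simp add: f_def)
        finally show ?thesis by (simp add: lz)
      next
        case nK: False
        show ?thesis
        proof (cases "j \<in> J")
          case True
          then have "0 \<le> l j + a j \<bullet> (y - x)" using nK by (simp add: K_def)
          then have "0 \<le> (1 - f i) * l j + f i * (l j + a j \<bullet> (y - x))"
            using f01[OF i] x(1)[OF True] by (intro add_nonneg_nonneg[OF mult_nonneg_nonneg mult_nonneg_nonneg]) simp_all
          also have "\<dots> = a j \<bullet> z + b j" unfolding lz by (simp add: algebra_simps)
          finally show ?thesis .
        next
          case False
          then show ?thesis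
            using yc that f01[OF i] x(2)[of j] by (auto simp: lz cone_def)
        qed
      qed
      moreover have "a i \<bullet> z + b i = 0"
        using neg[OF i] by (simp add: lz f_def)
      ultimately have "z \<in> convex hull (p ` (I - {i}))"
        using iJ J by (subst convex_hull_iff) auto
      moreover have "dist x z = f i * e"
        using f01[OF i] y by (simp add: z_def dist_norm norm_minus_commute)
      \<comment> \<open>\<open>z\<close> lies on the smaller sphere of radius
        \<open>f i * e\<close>; here the condition for all radii up to \<open>e\<close>
        enters.\<close>
      ultimately have "convex hull (p ` J) \<subseteq> convex hull (p ` (I - {i}))"
        using f01[OF i] e
        by (intro meets[of "f i * e"]) (auto simp: face_iff mult_le_cancel_right2)
      then have "J \<subseteq> I - {i}" using J by (simp add: convex_hull_subset_iff)
      then show False using iJ by blast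
    qed
    then have "0 \<le> l i + a i \<bullet> (y - x)" if "i \<in> J" for i
      using that unfolding K_def by force
    moreover have "0 \<le> l i + a i \<bullet> (y - x)" if "i \<in> I - J" for i
      using that yc x(2) by (auto simp: cone_def)
    ultimately show "y \<in> convex hull (p ` I)"
      unfolding convex_hull_iff[OF subset_refl] ly1 using J by blast
  qed
qed

text \<open>The coordinates in \<open>J\<close> are positive at a relative interior point, hence on
  a small ball around it. A face that meets the ball must then have all of \<open>J\<close> among
  its vertices.\<close>

lemma admissible_sphere_exists:
  assumes J: "J \<subseteq> I" "J \<noteq> {}"
  obtains x e where "admissible_sphere (convex hull (p ` J)) (convex hull (p ` I)) x e"
proof -
  have fJ: "finite J" using J finite_I finite_subset by blast
  have "rel_interior (convex hull (p ` J)) \<noteq> {}"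
    using J by (simp add: rel_interior_eq_empty)
  then obtain x where x: "x \<in> rel_interior (convex hull (p ` J))" by blast
  define W where "W = (\<Inter>i\<in>J. {y. 0 < a i \<bullet> y + b i})"
  have "open W"
    unfolding W_def using fJ
    by (intro open_INT ballI open_Collect_less continuous_intros) auto
  moreover have "x \<in> W" using x J by (auto simp: W_def rel_interior_iff)
  ultimately obtain e where e: "e > 0" "cball x e \<subseteq> W"
    using open_contains_cball by blast
  have "convex hull (p ` J) \<subseteq> G"
    if "0 < r" "r \<le> e" "G face_of convex hull (p ` I)" "sphere x r \<inter> G \<noteq> {}" for r G
  proof -
    obtain K where K: "K \<subseteq> I" "G = convex hull (p ` K)" using \<open>G face_of _\<close> unfolding face_iff by blast
    obtain y where y: "dist x y = r" "y \<in> G"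
      using \<open>sphere x r \<inter> G \<noteq> {}\<close> by (metis disjoint_iff mem_sphere)
    then have "y \<in> W" using e that by (auto simp: subset_iff)
    then have "J \<subseteq> K"
      using y(2) J K by (fastforce simp: W_def convex_hull_iff)
    then show ?thesis using J K by (simp add: convex_hull_subset_iff)
  qed
  with x e show ?thesis by (intro that[of x e]) (auto simp: admissible_sphere_def)
qed

text \<open>The region measured by \<open>sphere_vol\<close> is a copy of
  \<open>cball 0 1 \<inter> cone J\<close>, scaled by \<open>e\<close> and moved to
  \<open>x\<close>; the factors cancel in the quotient.\<close>

lemma sphere_vol_ratio:
  assumes J: "J \<subseteq> I"
    and adm: "admissible_sphere (convex hull (p ` J)) (convex hull (p ` I)) x e"
  shows "sphere_vol x e (sphere x e \<inter> convex hull (p ` I)) / sphere_vol x e (sphere x e) =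
    measure lebesgue (cball 0 1 \<inter> cone J) / measure lebesgue (cball (0::'a) 1)"
proof -
  have e: "e > 0" using adm by (simp add: admissible_sphere_def)
  \<comment> \<open>A nonzero \<open>v\<close> in \<open>S\<close> is required because over an empty
    patch the left side is empty, while the right side may contain \<open>x\<close>.\<close>
  have sph: "{x + t *\<^sub>R (y - x) | t y. t \<in> {0..1} \<and> y \<in> sphere x e \<inter> A} =
      (\<lambda>u. e *\<^sub>R u + x) ` (cball 0 1 \<inter> S)" (is "?L = ?R")
    if mem: "\<And>y. dist x y = e \<Longrightarrow> y \<in> A \<longleftrightarrow> y - x \<in> S"
      and scale: "\<And>u t. \<lbrakk>u \<in> S; 0 \<le> t\<rbrakk> \<Longrightarrow> t *\<^sub>R u \<in> S"
      and v: "v \<in> S" "v \<noteq> 0" for A S and v :: 'a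
  proof (intro equalityI subsetI)
    fix z assume "z \<in> ?L"
    then obtain t y where z: "z = x + t *\<^sub>R (y - x)" "0 \<le> t" "t \<le> 1" "dist x y = e" "y \<in> A" by auto
    have "z = e *\<^sub>R ((t / e) *\<^sub>R (y - x)) + x" using e z(1) by simp
    moreover have "(t / e) *\<^sub>R (y - x) \<in> cball 0 1 \<inter> S"
      using z(2-5) e mem[OF z(4)] scale[of "y - x" "t / e"] by (simp add: dist_norm norm_minus_commute)
    ultimately show "z \<in> ?R" by (rule image_eqI)
  next
    fix z assume "z \<in> ?R"
    then obtain u where "z = e *\<^sub>R u + x" "u \<in> cball 0 1 \<inter> S" by (rule imageE)
    then have u: "z = e *\<^sub>R u + x" "norm u \<le> 1" "u \<in> S" by simp_all
    \<comment> \<open>The origin has no direction of its own; that of \<open>v\<close> is used, with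
      coefficient \<open>norm u = 0\<close>.\<close>
    define w where "w = (if u = 0 then v else u)"
    have w: "w \<noteq> 0" "w \<in> S" using u v by (auto simp: w_def)
    define y where "y = x + (e / norm w) *\<^sub>R w"
    have "dist x y = e" using e w by (simp add: y_def dist_norm)
    moreover have "y \<in> A"
      using mem[OF \<open>dist x y = e\<close>] scale[OF w(2), of "e / norm w"] e by (simp add: y_def)
    moreover have "e *\<^sub>R u = norm u *\<^sub>R ((e / norm w) *\<^sub>R w)"
      by (simp add: w_def)
    then have "z = x + norm u *\<^sub>R (y - x)" using u by (simp add: y_def)
    ultimately show "z \<in> ?L"
      unfolding mem_Collect_eq using u(2) by (intro exI[of _ "norm u"] exI[of _ y]) simp
  qed
  have scale: "t *\<^sub>R u \<in> cone J" if "u \<in> cone J" "0 \<le> t" for u t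
    using that by (auto simp: cone_def)
  \<comment> \<open>The vector from \<open>x\<close> to a vertex other than \<open>x\<close> works;
    \<open>x\<close> itself may be a vertex.\<close>
  obtain v where v: "v \<in> cone J" "v \<noteq> 0"
  proof -
    have "card (p ` I) = DIM('a) + 1" using card_I by (simp add: card_image[OF inj_p])
    then have "p ` I \<noteq> {}" "p ` I \<noteq> {x}" by auto
    then obtain y where y: "y \<in> p ` I" "y \<noteq> x" by blast
    have xJ: "\<forall>i\<in>I - J. a i \<bullet> x + b i = 0"
      using adm J by (auto simp: admissible_sphere_def rel_interior_iff)
    have "0 \<le> a i \<bullet> (y - x)" if "i \<in> I - J" for i
    proof -
      have "a i \<bullet> (y - x) = (a i \<bullet> y + b i) - (a i \<bullet> x + b i)" by (simp add: inner_diff_right)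
      moreover have "0 \<le> a i \<bullet> y + b i" using y(1) that by (auto simp: dual)
      moreover have "a i \<bullet> x + b i = 0" using xJ that by blast
      ultimately show ?thesis by linarith
    qed
    then show ?thesis using that[of "y - x"] y by (auto simp: cone_def)
  qed
  have "{x + t *\<^sub>R (y - x) | t y. t \<in> {0..1} \<and> y \<in> sphere x e \<inter> convex hull (p ` I)} =
      (\<lambda>u. e *\<^sub>R u + x) ` (cball 0 1 \<inter> cone J)"
    by (rule sph[OF _ _ v]) (rule sphere_inter_simplex[OF J adm], assumption, rule scale)
  then have "sphere_vol x e (sphere x e \<inter> convex hull (p ` I)) =
      real DIM('a) / e * (e ^ DIM('a) * measure lebesgue (cball 0 1 \<inter> cone J))"
    using e unfolding sphere_vol_def by (simp only: measure_lebesgue_affine abs_of_pos)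
  moreover have "sphere_vol x e (sphere x e) =
      real DIM('a) / e * (e ^ DIM('a) * measure lebesgue (cball (0::'a) 1))"
    using sph[of UNIV UNIV v, simplified] v e
    by (simp add: sphere_vol_def measure_lebesgue_affine)
  ultimately show ?thesis using e by simp
qed

text \<open>An admissible sphere exists and all of them give the same ratio, so the definite
  description has a value.\<close>

lemma interior_angle_simplex:
  assumes "J \<subseteq> I" "J \<noteq> {}"
  shows "interior_angle (convex hull (p ` J)) (convex hull (p ` I)) =
    measure lebesgue (cball 0 1 \<inter> cone J) / measure lebesgue (cball (0::'a) 1)"
  unfolding interior_angle_def
  using admissible_sphere_exists[OF assms] sphere_vol_ratio[OF assms(1)]
  by (intro the_equality) metis+

lemma angle_sum_simplex:
  "angle_sum n (convex hull (p ` I)) =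
    (\<Sum>J | J \<subseteq> I \<and> card J = Suc n.
      measure lebesgue (cball 0 1 \<inter> cone J) / measure lebesgue (cball (0::'a) 1))"
proof -
  have ad: "aff_dim (convex hull (p ` J)) = int (card J) - 1" if "J \<subseteq> I" for J
  proof -
    have "\<not> affine_dependent (p ` J)"
      using affine_independent affine_dependent_subset that by blast
    moreover have "card (p ` J) = card J"
      using inj_p that by (meson card_image inj_on_subset)
    ultimately show ?thesis
      using aff_dim_affine_independent[of "p ` J"] by (simp add: aff_dim_convex_hull)
  qed
  have "{F. F face_of convex hull (p ` I) \<and> aff_dim F = int n} =
      (\<lambda>J. convex hull (p ` J)) ` {J. J \<subseteq> I \<and> card J = Suc n}"
  proof (intro equalityI subsetI)
    fix F assume "F \<in> {F. F face_of convex hull (p ` I) \<and> aff_dim F = int n}"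
    then obtain J where "J \<subseteq> I" "F = convex hull (p ` J)" "aff_dim F = int n"
      unfolding face_iff by blast
    with ad show "F \<in> (\<lambda>J. convex hull (p ` J)) ` {J. J \<subseteq> I \<and> card J = Suc n}"
      by (intro image_eqI[of _ _ J]) auto
  next
    fix F assume "F \<in> (\<lambda>J. convex hull (p ` J)) ` {J. J \<subseteq> I \<and> card J = Suc n}"
    then obtain J where "J \<subseteq> I" "card J = Suc n" "F = convex hull (p ` J)" by blast
    with ad show "F \<in> {F. F face_of convex hull (p ` I) \<and> aff_dim F = int n}"
      unfolding face_iff by auto
  qed
  moreover have "inj_on (\<lambda>J. convex hull (p ` J)) {J. J \<subseteq> I \<and> card J = Suc n}"
    by (rule inj_onI) (metis (mono_tags) convex_hull_subset_iff mem_Collect_eq order_refl subset_antisym)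
  ultimately show ?thesis
    unfolding angle_sum_def
    by (simp only: sum.reindex o_def) (rule sum.cong[OF refl], rule interior_angle_simplex, auto)
qed

end

section \<open>Frames of arbitrary simplices\<close>

text \<open>For a vertex \<open>v\<close>, affine independence yields a linear functional on the
  differences from another vertex \<open>c\<close> that is 1 at \<open>v - c\<close> and 0 at the
  others. Shifted by \<open>c\<close>, it is the coordinate at \<open>v\<close>.\<close>

lemma simplex_barycentric_frame:
  fixes \<Delta> :: "'a::euclidean_space set"
  assumes "int DIM('a) simplex \<Delta>"
  obtains C :: "'a set" and a b where "barycentric_frame C (\<lambda>v. v) a b" "\<Delta> = convex hull ((\<lambda>v. v) ` C)"
proof -
  obtain C where C: "finite C" "\<not> affine_dependent C" "card C = DIM('a) + 1" "\<Delta> = convex hull C"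
    using assms by (auto simp: simplex)
  have "\<exists>a b. \<forall>w\<in>C. (a::'a) \<bullet> w + b = (if v = w then 1 else 0)" if v: "v \<in> C" for v
  proof -
    have "card (C - {v}) \<noteq> 0" using v C by simp
    then obtain c where c: "c \<in> C" "c \<noteq> v" by (metis Diff_iff card.empty equals0I singleton_iff)
    have "independent ((\<lambda>x. -c + x) ` (C - {c}))"
      using C(2) affine_dependent_iff_dependent2[OF c(1)] by simp
    then obtain f :: "'a \<Rightarrow> real" where f: "linear f"
      "\<forall>x\<in>(\<lambda>x. -c + x) ` (C - {c}). f x = (if x = v - c then 1 else 0)"
      using linear_independent_extend[of _ "\<lambda>x. if x = v - c then 1 else (0::real)"] by blast
    \<comment> \<open>\<open>adjoint f 1\<close> is the vector that represents the functional
      \<open>f\<close>.\<close>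
    have fa: "f x = adjoint f 1 \<bullet> x" for x
      using adjoint_works[OF f(1), of x 1] by (simp add: inner_commute)
    have "adjoint f 1 \<bullet> w + - f c = (if v = w then 1 else 0)" if "w \<in> C" for w
    proof -
      have "adjoint f 1 \<bullet> w + - f c = f (w - c)" using f(1) by (simp add: fa[symmetric] linear_diff)
      also have "\<dots> = (if v = w then 1 else 0)"
        using f that c linear_0[OF f(1)] by (cases "w = c") auto
      finally show ?thesis .
    qed
    then show ?thesis by blast
  qed
  then obtain a b where "\<And>v w. \<lbrakk>v \<in> C; w \<in> C\<rbrakk> \<Longrightarrow> (a v::'a) \<bullet> w + b v = (if v = w then 1 else 0)"
    by metis
  then show ?thesis using C by (intro that[of C a b]) (unfold_locales, auto)
qed

subsection \<open>Angle sums as binomial moments\<close>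

definition ball_measure :: "'a::euclidean_space measure" where
  "ball_measure = uniform_measure lborel (cball 0 1)"

lemma emeasure_unit_ball:
  "emeasure lborel (cball (0::'a::euclidean_space) 1) \<noteq> 0"
  "emeasure lborel (cball (0::'a::euclidean_space) 1) \<noteq> \<infinity>"
  "measure lborel (cball (0::'a::euclidean_space) 1) \<noteq> 0"
proof -
  have *: "0 < measure lborel (cball (0::'a) 1)"
    using content_cball_pos[of 1 "0::'a"] by simp
  then show "emeasure lborel (cball (0::'a) 1) \<noteq> 0" "measure lborel (cball (0::'a) 1) \<noteq> 0"
    by (auto simp: measure_def)
  show "emeasure lborel (cball (0::'a) 1) \<noteq> \<infinity>"
    using emeasure_lborel_cball_finite[of "0::'a" 1] by simp
qed

lemma space_ball_measure [simp]: "space ball_measure = UNIV"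
  by (simp add: ball_measure_def)

lemma sets_ball_measure [simp, measurable_cong]: "sets ball_measure = sets borel"
  by (simp add: ball_measure_def)

lemma measure_ball_measure:
  fixes S :: "'a::euclidean_space set"
  assumes "S \<in> sets borel"
  shows "measure ball_measure S =
    measure lebesgue (cball 0 1 \<inter> S) / measure lebesgue (cball (0::'a) 1)"
  unfolding ball_measure_def using assms
  by (subst measure_uniform_measure[OF emeasure_unit_ball(1,2)]) (auto simp: measure_completion)

lemma measure_ball_measure_UNIV [simp]: "measure ball_measure UNIV = 1"
  unfolding ball_measure_def using emeasure_unit_ball(3)
  by (subst measure_uniform_measure[OF emeasure_unit_ball(1,2)]) auto

lemma finite_measure_ball_measure: "finite_measure ball_measure"
  by (rule finite_measureI) (use emeasure_unit_ball in \<open>auto simp: ball_measure_def ennreal_divide_eq_top_iff\<close>)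

interpretation ball_measure: finite_measure ball_measure
  by (rule finite_measure_ball_measure)

text \<open>Reflection in the origin preserves the ball and Lebesgue measure.\<close>

lemma measure_ball_measure_uminus:
  fixes S :: "'a::euclidean_space set"
  assumes "S \<in> sets borel"
  shows "measure ball_measure {u. - u \<in> S} = measure ball_measure S"
proof -
  have "{u. - u \<in> S} \<in> sets borel"
    using measurable_sets[of uminus borel borel S] assms by (simp add: vimage_def)
  moreover have "cball 0 1 \<inter> {u. - u \<in> S} = (\<lambda>u. (-1) *\<^sub>R u + 0) ` (cball 0 1 \<inter> S)"
    by (auto simp: image_iff intro: bexI[of _ "- _"]) (metis IntI add.inverse_inverse mem_cball_0 norm_minus_cancel)
  ultimately show ?thesis
    using assms measure_lebesgue_affine[of "-1" "0::'a" "cball 0 1 \<inter> S"]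
    by (simp add: measure_ball_measure)
qed

lemma AE_ball_measure_hyperplane:
  assumes "a \<noteq> 0" shows "AE u in ball_measure. a \<bullet> u \<noteq> 0"
proof -
  have "{u. a \<bullet> u = 0} \<in> null_sets lebesgue"
    using negligible_hyperplane[of a 0] assms by (simp add: negligible_iff_null_sets)
  then have "AE u in lborel. a \<bullet> u \<noteq> 0"
    using AE_not_in[of "{u. a \<bullet> u = 0}" lebesgue] by (simp add: AE_completion_iff)
  then show ?thesis
    unfolding ball_measure_def by (intro AE_uniform_measureI) auto
qed

text \<open>The random number \<open>N\<close>, defined for any family of vectors so that negated
  and degenerating normals are covered as well.\<close>

definition sign_count :: "'i set \<Rightarrow> ('i \<Rightarrow> 'a::euclidean_space) \<Rightarrow> 'a \<Rightarrow> nat" where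
  "sign_count I a u = card {i \<in> I. 0 \<le> a i \<bullet> u}"

lemma sign_count_measurable [measurable]:
  assumes "finite I"
  shows "sign_count I a \<in> measurable borel (count_space UNIV)"
proof -
  have "(\<lambda>u. real (sign_count I a u)) = (\<lambda>u. \<Sum>i\<in>I. indicator {u. 0 \<le> a i \<bullet> u} u)"
    using assms by (simp add: sign_count_def indicator_def sum.If_cases Int_def)
  then have "(\<lambda>u. real (sign_count I a u)) \<in> borel_measurable borel"
    by simp
  then have "(\<lambda>u. real (sign_count I a u)) -` {real n} \<inter> space borel \<in> sets borel" for n
    by (rule measurable_sets) simp
  then show ?thesis
    unfolding measurable_count_space_eq2_countable by (simp add: vimage_def)
qed

lemma sign_count_le: "finite I \<Longrightarrow> sign_count I a u \<le> card I"
  unfolding sign_count_def by (intro card_mono) auto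

lemma integrable_sign_count:
  assumes "finite I"
  shows "integrable ball_measure (\<lambda>u. f (sign_count I a u) :: real)"
proof (rule ball_measure.integrable_const_bound)
  show "AE u in ball_measure. norm (f (sign_count I a u)) \<le> (\<Sum>n\<le>card I. norm (f n))"
    using sign_count_le[OF assms] by (intro AE_I2 member_le_sum) auto
qed (use assms in measurable)

text \<open>Double counting: the sets \<open>T\<close> whose condition holds at \<open>u\<close> are
  the \<open>j\<close>-subsets of the index set counted by \<open>sign_count I a u\<close>.\<close>

lemma sum_measure_orthants:
  assumes I: "finite I"
  shows "(\<Sum>T | T \<subseteq> I \<and> card T = j. measure ball_measure {u. \<forall>i\<in>T. 0 \<le> a i \<bullet> u}) =
    (\<integral>u. real (sign_count I a u choose j) \<partial>ball_measure)"
proof -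
  let ?S = "{T. T \<subseteq> I \<and> card T = j}"
  have fS: "finite ?S" using I by (auto intro: finite_subset[of _ "Pow I"])
  have m: "{u. \<forall>i\<in>T. 0 \<le> a i \<bullet> u} \<in> sets borel" if "T \<in> ?S" for T
  proof -
    have "finite T" using that I finite_subset by auto
    then show ?thesis by measurable
  qed
  have "(\<Sum>T\<in>?S. indicator {u. \<forall>i\<in>T. 0 \<le> a i \<bullet> u} u) = real (sign_count I a u choose j)" for u
  proof -
    have "(\<Sum>T\<in>?S. indicator {u. \<forall>i\<in>T. 0 \<le> a i \<bullet> u} u) = real (card {T \<in> ?S. \<forall>i\<in>T. 0 \<le> a i \<bullet> u})"
      using fS by (simp add: indicator_def sum.If_cases Int_def)
    also have "{T \<in> ?S. \<forall>i\<in>T. 0 \<le> a i \<bullet> u} = {T. T \<subseteq> {i \<in> I. 0 \<le> a i \<bullet> u} \<and> card T = j}"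
      by auto
    finally show ?thesis
      using I by (simp add: n_subsets sign_count_def)
  qed
  then have "(\<integral>u. real (sign_count I a u choose j) \<partial>ball_measure) =
      (\<integral>u. (\<Sum>T\<in>?S. indicator {u. \<forall>i\<in>T. 0 \<le> a i \<bullet> u} u) \<partial>ball_measure)"
    by simp
  also have "\<dots> = (\<Sum>T\<in>?S. measure ball_measure {u. \<forall>i\<in>T. 0 \<le> a i \<bullet> u})"
    using m by (subst Bochner_Integration.integral_sum) (auto simp: less_top[symmetric])
  finally show ?thesis by simp
qed

text \<open>For \<open>n \<le> m\<close>, the binomial moment of order \<open>j\<close> of the
  uniform distribution on \<open>{n, m - n}\<close>; \<open>m\<close> will be the number of
  normals.\<close>

definition symmetric_choose :: "nat \<Rightarrow> nat \<Rightarrow> nat \<Rightarrow> real" where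
  "symmetric_choose m j n = (real (n choose j) + real ((m - n) choose j)) / 2"

lemma symmetric_choose_flip: "n \<le> m \<Longrightarrow> symmetric_choose m j (m - n) = symmetric_choose m j n"
  by (simp add: symmetric_choose_def)

context barycentric_frame
begin

lemma AE_normals_nonzero: "AE u in ball_measure. \<forall>i\<in>I. a i \<bullet> u \<noteq> 0"
  using finite_I by (intro AE_finite_allI AE_ball_measure_hyperplane normal_nonzero)

text \<open>Off the hyperplanes, each index counts for exactly one of the two signs.\<close>

lemma sign_count_uminus:
  assumes "\<forall>i\<in>I. a i \<bullet> u \<noteq> 0"
  shows "sign_count I (\<lambda>i. - a i) u = DIM('a) + 1 - sign_count I a u"
proof -
  have "{i \<in> I. 0 \<le> - a i \<bullet> u} = I - {i \<in> I. 0 \<le> a i \<bullet> u}"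
    using assms by force
  then show ?thesis
    using finite_I card_I by (simp add: sign_count_def card_Diff_subset)
qed

text \<open>The products \<open>a i \<bullet> u\<close> sum to 0, so they are neither all negative
  nor all positive.\<close>

lemma sign_count_bounds:
  assumes "\<forall>i\<in>I. a i \<bullet> u \<noteq> 0"
  shows "sign_count I a u \<in> {1..DIM('a)}"
proof -
  have ne: "I \<noteq> {}" using card_I by auto
  \<comment> \<open>\<open>c = 1\<close> rules out the count 0, and \<open>c = -1\<close> the count
    \<open>DIM('a) + 1\<close>.\<close>
  have 1: "\<exists>i\<in>I. 0 \<le> c * (a i \<bullet> u)" if "c \<noteq> 0" for c
  proof (rule ccontr)
    assume "\<not> ?thesis"
    then have "(\<Sum>i\<in>I. c * (a i \<bullet> u)) < 0"
      using finite_I ne sum_strict_mono[of I "\<lambda>i. c * (a i \<bullet> u)" "\<lambda>_. 0"] by (simp add: not_le)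
    then show False using sum_normals[of u] by (simp add: sum_distrib_left[symmetric])
  qed
  have "{i \<in> I. 0 \<le> a i \<bullet> u} \<noteq> {}" using 1[of 1] by auto
  moreover have "{i \<in> I. 0 \<le> a i \<bullet> u} \<subset> I"
  proof -
    obtain i where "i \<in> I" "a i \<bullet> u \<le> 0" using 1[of "-1"] by auto
    then have "i \<in> I" "\<not> 0 \<le> a i \<bullet> u" using assms by force+
    then show ?thesis by blast
  qed
  ultimately show ?thesis
    using psubset_card_mono[OF finite_I, of "{i \<in> I. 0 \<le> a i \<bullet> u}"] finite_I card_I
    by (auto simp: sign_count_def Suc_le_eq card_gt_0_iff)
qed

text \<open>A face with \<open>n + 1\<close> vertices lies on \<open>DIM('a) - n\<close> facets, so
  the angle sum is a binomial moment of that order. Averaging with the negated normals makes the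
  integrand symmetric.\<close>

lemma angle_sum_eq_integral:
  assumes n: "n \<le> DIM('a)"
  shows "angle_sum n (convex hull (p ` I)) =
    (\<integral>u. symmetric_choose (DIM('a) + 1) (DIM('a) - n) (sign_count I a u) \<partial>ball_measure)"
proof -
  let ?j = "DIM('a) - n" and ?P = "\<lambda>a T. measure ball_measure {u::'a. \<forall>i\<in>T. 0 \<le> a i \<bullet> u}"
  let ?S = "{T. T \<subseteq> I \<and> card T = ?j}"
  have borel: "{u. \<forall>i\<in>T. 0 \<le> a i \<bullet> u} \<in> sets borel" if "T \<subseteq> I" for T
  proof -
    have "finite T" using that finite_I finite_subset by auto
    then show ?thesis by measurable
  qed
  have "angle_sum n (convex hull (p ` I)) = (\<Sum>J | J \<subseteq> I \<and> card J = Suc n. ?P a (I - J))"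
    unfolding angle_sum_simplex cone_def
    by (intro sum.cong refl measure_ball_measure[symmetric] borel) auto
  also have "\<dots> = (\<Sum>T\<in>?S. ?P a T)"
    using n finite_I card_I
    by (intro sum.reindex_bij_witness[of _ "\<lambda>T. I - T" "\<lambda>J. I - J"])
      (auto simp: card_Diff_subset finite_subset double_diff)
  finally have 1: "angle_sum n (convex hull (p ` I)) = (\<Sum>T\<in>?S. ?P a T)" .
  \<comment> \<open>The central symmetry of the ball lets \<open>- a\<close> replace
    \<open>a\<close>; the mean of both expressions is taken next.\<close>
  have "?P (\<lambda>i. - a i) T = ?P a T" if "T \<in> ?S" for T
    using measure_ball_measure_uminus[OF borel, of T] that by simp
  then have "(\<Sum>T\<in>?S. ?P a T) = (\<Sum>T\<in>?S. ?P (\<lambda>i. - a i) T)" by simp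
  with 1 have "angle_sum n (convex hull (p ` I)) =
      ((\<integral>u. real (sign_count I a u choose ?j) \<partial>ball_measure) +
       (\<integral>u. real (sign_count I (\<lambda>i. - a i) u choose ?j) \<partial>ball_measure)) / 2"
    unfolding sum_measure_orthants[OF finite_I] by simp
  also have "\<dots> = (\<integral>u. (real (sign_count I a u choose ?j) +
      real (sign_count I (\<lambda>i. - a i) u choose ?j)) / 2 \<partial>ball_measure)"
    using Bochner_Integration.integral_add[OF integrable_sign_count integrable_sign_count,
        OF finite_I finite_I, of "\<lambda>k. real (k choose ?j)" a "\<lambda>k. real (k choose ?j)" "\<lambda>i. - a i"]
    by simp
  also have "\<dots> = (\<integral>u. symmetric_choose (DIM('a) + 1) ?j (sign_count I a u) \<partial>ball_measure)"
  proof (rule integral_cong_AE)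
    show "AE u in ball_measure. (real (sign_count I a u choose ?j) +
      real (sign_count I (\<lambda>i. - a i) u choose ?j)) / 2 =
      symmetric_choose (DIM('a) + 1) ?j (sign_count I a u)"
      using AE_normals_nonzero
      by eventually_elim (simp only: symmetric_choose_def sign_count_uminus)
  qed (use finite_I in \<open>simp_all add: borel_measurable_integrable integrable_sign_count\<close>)
  finally show ?thesis .
qed

text \<open>By \<open>sign_count_bounds\<close> the count almost surely lies in
  \<open>{1..DIM('a)}\<close>, so its distribution consists of finitely many weights.\<close>

lemma integral_sign_count:
  "(\<integral>u. f (sign_count I a u) \<partial>ball_measure) =
    (\<Sum>k\<in>{1..DIM('a)}. measure ball_measure {u. sign_count I a u = k} * (f k :: real))"
proof -
  have m: "{u. sign_count I a u = k} \<in> sets borel" for k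
    using measurable_sets[OF sign_count_measurable[OF finite_I, of a], of "{k}"]
    by (simp add: vimage_def)
  have "(\<integral>u. f (sign_count I a u) \<partial>ball_measure) =
      (\<integral>u. (\<Sum>k\<in>{1..DIM('a)}. indicator {u. sign_count I a u = k} u * f k) \<partial>ball_measure)"
  proof (rule integral_cong_AE)
    show "AE u in ball_measure. f (sign_count I a u) =
        (\<Sum>k\<in>{1..DIM('a)}. indicator {u. sign_count I a u = k} u * f k)"
      using AE_normals_nonzero
    proof eventually_elim
      fix u assume "\<forall>i\<in>I. a i \<bullet> u \<noteq> 0"
      then have "sign_count I a u \<in> {1..DIM('a)}" by (rule sign_count_bounds)
      then show "f (sign_count I a u) =
          (\<Sum>k\<in>{1..DIM('a)}. indicator {u. sign_count I a u = k} u * f k)"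
        by (simp add: indicator_def if_distrib[of "\<lambda>x. x * _"] cong: if_cong)
    qed
  qed (use m in \<open>simp_all add: borel_measurable_integrable integrable_sign_count finite_I\<close>)
  also have "\<dots> = (\<Sum>k\<in>{1..DIM('a)}. measure ball_measure {u. sign_count I a u = k} * f k)"
    using m by (subst Bochner_Integration.integral_sum) (auto simp: less_top[symmetric])
  finally show ?thesis .
qed

end

subsection \<open>Limits of degenerating simplices\<close>

text \<open>The vectors \<open>q\<^sub>k\<close>. The order \<open>d - idx j\<close> is the number
  of facets through a face of dimension \<open>idx j\<close>.\<close>

definition limit_alpha_vector :: "('m::finite \<Rightarrow> nat) \<Rightarrow> nat \<Rightarrow> nat \<Rightarrow> real ^ 'm" where
  "limit_alpha_vector idx d k = (\<chi> j. symmetric_choose (d + 1) (d - idx j) k)"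

text \<open>The weights are the probabilities of the values of \<open>sign_count\<close>, the same
  for every coordinate.\<close>

lemma (in barycentric_frame) alpha_vector_in_convex_hull:
  assumes idx: "\<And>j. idx j \<le> DIM('a)"
  shows "alpha_vector idx (convex hull (p ` I)) \<in>
    convex hull (limit_alpha_vector idx DIM('a) ` {1..DIM('a)})"
proof -
  let ?w = "\<lambda>k. measure ball_measure {u. sign_count I a u = k}"
  have "alpha_vector idx (convex hull (p ` I)) =
      (\<Sum>k\<in>{1..DIM('a)}. ?w k *\<^sub>R limit_alpha_vector idx DIM('a) k)"
    by (simp add: vec_eq_iff alpha_vector_def limit_alpha_vector_def angle_sum_eq_integral[OF idx]
        integral_sign_count)
  also have "\<dots> \<in> convex hull (limit_alpha_vector idx DIM('a) ` {1..DIM('a)})"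
  proof (rule convex_sum)
    show "(\<Sum>k\<in>{1..DIM('a)}. ?w k) = 1"
      using integral_sign_count[of "\<lambda>_. 1"] by simp
  qed (auto intro: hull_inc)
  finally show ?thesis .
qed

section \<open>Linear independence of the limit vectors\<close>

text \<open>Triangular shape: at the coordinate with index \<open>k - 1\<close> the binomial order
  is \<open>d + 1 - k\<close>. There \<open>q\<^sub>k\<close> is positive, while
  \<open>q\<^sub>l\<close> with \<open>k < l \<le> m\<close> vanishes, since \<open>l\<close> and
  \<open>d + 1 - l\<close> are both below the order.\<close>

lemma independent_limit_alpha_vectors:
  fixes idx :: "'m::finite \<Rightarrow> nat"
  assumes idx: "bij_betw idx UNIV {0..d}"
  defines "m \<equiv> (d + 1) div 2"
  shows "inj_on (limit_alpha_vector idx d) {1..m}"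
    and "independent (limit_alpha_vector idx d ` {1..m})"
proof -
  let ?q = "limit_alpha_vector idx d"
  \<comment> \<open>Vectors are added from index \<open>m\<close> downwards, since each is separated
    from those of larger index.\<close>
  have "inj_on ?q {m - r<..m} \<and> independent (?q ` {m - r<..m})" if "r \<le> m" for r
    using that
  proof (induction r)
    case 0
    then show ?case by (simp add: independent_empty)
  next
    case (Suc r)
    define k where "k = m - r"
    have k: "1 \<le> k" "k \<le> m" and split: "{m - Suc r<..m} = insert k {m - r<..m}"
      using Suc.prems by (auto simp: k_def)
    have km: "k \<le> d" using k unfolding m_def by linarith
    obtain j where j: "idx j = k - 1"
      using bij_betw_imp_surj_on[OF idx] km by (metis atLeastAtMost_iff diff_le_self le0 le_trans imageE)
    have dj: "d - idx j = d + 1 - k" using j k km by simp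
    have "?q k $ j > 0"
      using dj by (simp add: limit_alpha_vector_def symmetric_choose_def)
    moreover have "span (?q ` {m - r<..m}) \<subseteq> {x. x $ j = 0}"
    proof (rule span_minimal)
      show "?q ` {m - r<..m} \<subseteq> {x. x $ j = 0}"
      proof clarify
        fix l assume l: "l \<in> {m - r<..m}"
        then have "k < l" "2 * l \<le> d + 1" unfolding m_def k_def by auto
        then have "l < d + 1 - k" "d + 1 - l < d + 1 - k" by linarith+
        then show "?q l $ j = 0"
          by (simp add: limit_alpha_vector_def symmetric_choose_def dj binomial_eq_0)
      qed
    qed (simp add: subspace_def)
    ultimately have "?q k \<notin> span (?q ` {m - r<..m})" by auto
    moreover from this have "?q k \<notin> ?q ` {m - r<..m}"
      by (rule contrapos_nn) (rule span_base)
    moreover have "{m - r<..m} - {k} = {m - r<..m}" by (auto simp: k_def)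
    ultimately show ?case
      unfolding split using Suc by (simp add: independent_insert)
  qed
  moreover have "{m - m<..m} = {1..m}" by auto
  ultimately show "inj_on ?q {1..m}" "independent (?q ` {1..m})"
    by (metis order_refl)+
qed

section \<open>Convergence for nearly parallel normals\<close>

text \<open>The product of \<open>u\<close> with the perturbed normal tends to
  \<open>c i * (w \<bullet> u)\<close>, which is nonzero and so eventually fixes its sign. For
  negative \<open>w \<bullet> u\<close> all signs are swapped.\<close>

lemma sign_count_eventually:
  fixes w :: "'a::euclidean_space" and c :: "'i \<Rightarrow> real" and v :: "'i \<Rightarrow> 'a" and t :: "nat \<Rightarrow> real"
  assumes I: "finite I" and c: "\<And>i. i \<in> I \<Longrightarrow> c i \<noteq> 0" and u: "w \<bullet> u \<noteq> 0"
    and t: "t \<longlonglongrightarrow> 0"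
  defines "k \<equiv> card {i \<in> I. 0 < c i}"
  shows "\<forall>\<^sub>F m in sequentially. sign_count I (\<lambda>i. c i *\<^sub>R w + t m *\<^sub>R v i) u =
    (if 0 < w \<bullet> u then k else card I - k)"
proof -
  have "\<forall>\<^sub>F m in sequentially. 0 \<le> (c i *\<^sub>R w + t m *\<^sub>R v i) \<bullet> u \<longleftrightarrow> 0 < c i * (w \<bullet> u)"
    if i: "i \<in> I" for i
  proof -
    have lim: "(\<lambda>m. c i * (w \<bullet> u) + t m * (v i \<bullet> u)) \<longlonglongrightarrow> c i * (w \<bullet> u)"
      using tendsto_add[OF tendsto_const tendsto_mult[OF t tendsto_const],
          of "c i * (w \<bullet> u)" "v i \<bullet> u"] by simp
    consider "0 < c i * (w \<bullet> u)" | "c i * (w \<bullet> u) < 0"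
      using c[OF i] u by (metis linorder_neqE mult_eq_0_iff)
    then show ?thesis
    proof cases
      case 1
      from order_tendstoD(1)[OF lim 1] show ?thesis
        by eventually_elim (use 1 in \<open>simp add: inner_add_left\<close>)
    next
      case 2
      from order_tendstoD(2)[OF lim 2] show ?thesis
        by eventually_elim (use 2 in \<open>simp add: inner_add_left\<close>)
    qed
  qed
  then have "\<forall>\<^sub>F m in sequentially. \<forall>i\<in>I. 0 \<le> (c i *\<^sub>R w + t m *\<^sub>R v i) \<bullet> u \<longleftrightarrow> 0 < c i * (w \<bullet> u)"
    using I by (simp add: eventually_ball_finite)
  then show ?thesis
  proof eventually_elim
    case (elim m)
    then have *: "{i \<in> I. 0 \<le> (c i *\<^sub>R w + t m *\<^sub>R v i) \<bullet> u} = {i \<in> I. 0 < c i * (w \<bullet> u)}"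
      by blast
    show ?case
    proof (cases "0 < w \<bullet> u")
      case True
      then show ?thesis by (simp add: sign_count_def * k_def zero_less_mult_iff)
    next
      case False
      have "{i \<in> I. 0 < c i * (w \<bullet> u)} = I - {i \<in> I. 0 < c i}"
        using False u c by (force simp: zero_less_mult_iff)
      then show ?thesis
        using False I by (simp add: sign_count_def * k_def card_Diff_subset)
    qed
  qed
qed

text \<open>Dominated convergence. Both possible limits of the count give the same value of
  \<open>symmetric_choose\<close>, so the pointwise limit is almost everywhere constant.\<close>

lemma integral_symmetric_choose_tendsto:
  fixes w :: "'a::euclidean_space" and c :: "'i \<Rightarrow> real" and v :: "'i \<Rightarrow> 'a" and t :: "nat \<Rightarrow> real"
  assumes I: "finite I" and c: "\<And>i. i \<in> I \<Longrightarrow> c i \<noteq> 0" and w: "w \<noteq> 0" and t: "t \<longlonglongrightarrow> 0"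
  shows "(\<lambda>m. \<integral>u. symmetric_choose (card I) j (sign_count I (\<lambda>i. c i *\<^sub>R w + t m *\<^sub>R v i) u) \<partial>ball_measure)
    \<longlonglongrightarrow> symmetric_choose (card I) j (card {i \<in> I. 0 < c i})"
proof -
  let ?f = "symmetric_choose (card I) j" and ?N = "\<lambda>m. sign_count I (\<lambda>i. c i *\<^sub>R w + t m *\<^sub>R v i)"
  let ?k = "card {i \<in> I. 0 < c i}"
  have k: "?k \<le> card I" using I by (intro card_mono) auto
  have "(\<lambda>m. \<integral>u. ?f (?N m u) \<partial>ball_measure) \<longlonglongrightarrow> (\<integral>u. ?f ?k \<partial>(ball_measure :: 'a measure))"
  proof (rule integral_dominated_convergence)
    show "AE u in ball_measure. (\<lambda>m. ?f (?N m u)) \<longlonglongrightarrow> ?f ?k"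
      using AE_ball_measure_hyperplane[OF w]
    proof eventually_elim
      case (elim u)
      have "\<forall>\<^sub>F m in sequentially. ?N m u = (if 0 < w \<bullet> u then ?k else card I - ?k)"
        by (rule sign_count_eventually[OF I c elim t])
      then have "\<forall>\<^sub>F m in sequentially. ?f (?N m u) = ?f ?k"
        by eventually_elim (use symmetric_choose_flip[OF k] in auto)
      then show ?case by (rule tendsto_eventually)
    qed
    show "AE u in ball_measure. norm (?f (?N m u)) \<le> (\<Sum>n\<le>card I. norm (?f n))" for m
      using sign_count_le[OF I] by (intro AE_I2 member_le_sum) auto
  qed (use I in \<open>auto intro: borel_measurable_integrable integrable_sign_count\<close>)
  then show ?thesis by simp
qed

text \<open>The vector is a limit of \<alpha>-vectors of simplices, and affine hulls in finite
  dimension are closed.\<close>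

lemma limit_alpha_vector_in_affine_hull:
  fixes idx :: "'m::finite \<Rightarrow> nat"
  assumes idx: "\<And>j. idx j \<le> CARD('n::finite)" and k: "k \<in> {1..CARD('n)}"
  shows "limit_alpha_vector idx CARD('n) k \<in>
    affine hull {alpha_vector idx \<Delta> | \<Delta> :: (real ^ 'n) set. int CARD('n) simplex \<Delta>}"
    (is "_ \<in> affine hull ?A")
proof -
  let ?d = "CARD('n)"
  obtain K :: "'n set" where K: "card K = k"
    using k obtain_subset_with_card_n[of k "UNIV :: 'n set"] by auto
  \<comment> \<open>The entry \<open>real ?d + 1\<close> makes the coordinate sum of
    \<open>w\<close> positive as soon as \<open>k \<ge> 1\<close>. Hence \<open>c None\<close> is
    negative, and exactly the \<open>k\<close> indices from \<open>K\<close> have positive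
    \<open>c\<close>.\<close>
  define w :: "real ^ 'n" where "w = (\<chi> i. if i \<in> K then real ?d + 1 else - 1)"
  define c where "c i = (case i of None \<Rightarrow> - (\<Sum>i\<in>UNIV. w $ i) | Some i \<Rightarrow> w $ i)" for i
  \<comment> \<open>These are facet normals of the standard simplex. Both \<open>c\<close> and
    \<open>v\<close> sum to 0, hence so do the perturbed normals.\<close>
  define v :: "'n option \<Rightarrow> real ^ 'n" where
    "v i = (case i of None \<Rightarrow> - (\<Sum>i\<in>UNIV. axis i 1) | Some i \<Rightarrow> axis i 1)" for i
  define t where "t m = inverse (real (Suc m))" for m
  have t: "t \<longlonglongrightarrow> 0" "\<And>m. t m > 0"
    unfolding t_def using LIMSEQ_inverse_real_of_nat by auto
  have sum_w: "(\<Sum>i\<in>UNIV. w $ i) = real k * (real ?d + 1) - (real ?d - real k)"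
    using k K by (simp add: w_def sum.If_cases Compl_eq_Diff_UNIV card_Diff_subset of_nat_diff)
  have pos: "(\<Sum>i\<in>UNIV. w $ i) > 0"
  proof -
    have "real ?d < 1 * (real ?d + 1)" by simp
    also have "\<dots> \<le> real k * (real ?d + 1)"
      using k by (intro mult_right_mono) auto
    finally have "real ?d < real k * (real ?d + 1)" .
    then show ?thesis unfolding sum_w by simp
  qed
  have c0: "c i \<noteq> 0" for i
    using pos by (cases i) (auto simp: c_def w_def)
  have "{i. 0 < c i} = Some ` K"
    using pos by (auto simp: c_def w_def image_iff split: option.splits if_splits)
  then have card_pos: "card {i \<in> UNIV. 0 < c i} = k"
    using K by (simp add: card_image)
  have w0: "w \<noteq> 0"
  proof
    assume "w = 0" with pos show False by simp
  qed
  have "\<exists>p b. barycentric_frame UNIV p (\<lambda>i. c i *\<^sub>R w + t m *\<^sub>R v i) b" for m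
  proof -
    \<comment> \<open>The coordinates of \<open>L x\<close> are the products of \<open>x\<close>
      with the normals indexed by \<open>Some i\<close>. \<open>L\<close> is positive definite,
      hence invertible.\<close>
    define L where "L x = (w \<bullet> x) *\<^sub>R w + t m *\<^sub>R x" for x
    have lin: "linear L"
      unfolding L_def by (intro linearI) (simp_all add: algebra_simps)
    have "x = 0" if "L x = 0" for x
    proof -
      have "(w \<bullet> x) * (w \<bullet> x) + t m * (x \<bullet> x) = L x \<bullet> x"
        by (simp add: L_def inner_add_left)
      then have "(w \<bullet> x) * (w \<bullet> x) + t m * (x \<bullet> x) = 0" using that by simp
      then have "t m * (x \<bullet> x) \<le> 0" by (smt (verit) zero_le_square)
      then have "x \<bullet> x \<le> 0" using t(2)[of m] by (simp add: mult_le_0_iff)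
      then show "x = 0" by (metis inner_eq_zero_iff inner_ge_zero order_antisym)
    qed
    then have "inj L" using lin by (simp add: linear_injective_0)
    with lin have "surj L" by (rule linear_inj_imp_surj)
    then have "\<forall>i. \<exists>x. L x = axis i 1" by (metis surjD)
    then obtain g where g: "\<And>i. L (g i) = axis i 1" by metis
    \<comment> \<open>The preimages of 0 and of the unit vectors under \<open>L\<close> are the
      vertices dual to the normals, with offset 1 at \<open>None\<close> and 0 elsewhere.\<close>
    define p where "p i = (case i of None \<Rightarrow> 0 | Some i \<Rightarrow> g i)" for i
    have some: "(c (Some i) *\<^sub>R w + t m *\<^sub>R v (Some i)) \<bullet> x = L x $ i" for i x
      by (simp add: c_def v_def L_def inner_add_left inner_axis' mult.commute)
    have none: "(c None *\<^sub>R w + t m *\<^sub>R v None) \<bullet> x = - (\<Sum>i\<in>UNIV. L x $ i)" for x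
      by (simp add: c_def v_def L_def inner_add_left inner_diff_left inner_sum_left inner_axis' sum.distrib
          sum_distrib_left sum_distrib_right mult.commute)
    have "L 0 = 0" using lin by (rule linear_0)
    then have "barycentric_frame UNIV p (\<lambda>i. c i *\<^sub>R w + t m *\<^sub>R v i)
        (\<lambda>i. case i of None \<Rightarrow> 1 | Some i \<Rightarrow> 0)"
      by unfold_locales
        (auto simp: card_UNIV_option p_def some none g axis_def split: option.split)
    then show ?thesis by blast
  qed
  then obtain p b where frame: "\<And>m. barycentric_frame UNIV (p m) (\<lambda>i. c i *\<^sub>R w + t m *\<^sub>R v i) (b m)"
    by metis
  have mem: "alpha_vector idx (convex hull (range (p m))) \<in> ?A" for m
  proof -
    interpret barycentric_frame UNIV "p m" "\<lambda>i. c i *\<^sub>R w + t m *\<^sub>R v i" "b m" by (rule frame)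
    have "int ?d simplex (convex hull (range (p m)))"
      unfolding simplex_def using affine_independent card_image[OF inj_p] by (auto simp: card_UNIV_option)
    then show ?thesis by blast
  qed
  have "(\<lambda>m. alpha_vector idx (convex hull (range (p m)))) \<longlonglongrightarrow> limit_alpha_vector idx ?d k"
  proof (rule vec_tendstoI)
    fix j
    have "angle_sum (idx j) (convex hull (range (p m))) =
        (\<integral>u. symmetric_choose (card (UNIV :: 'n option set)) (?d - idx j)
          (sign_count UNIV (\<lambda>i. c i *\<^sub>R w + t m *\<^sub>R v i) u) \<partial>ball_measure)" for m
      using barycentric_frame.angle_sum_eq_integral[OF frame, of "idx j" m] idx
      by (simp add: card_UNIV_option)
    then show "(\<lambda>m. alpha_vector idx (convex hull (range (p m))) $ j)
        \<longlonglongrightarrow> limit_alpha_vector idx ?d k $ j"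
      using integral_symmetric_choose_tendsto[where c = c and v = v and j = "?d - idx j",
          OF finite_class.finite_UNIV c0 w0 t(1)]
      by (simp add: alpha_vector_def limit_alpha_vector_def card_pos[simplified] card_UNIV_option)
  qed
  moreover have "alpha_vector idx (convex hull (range (p m))) \<in> affine hull ?A" for m
    using mem by (rule hull_inc)
  ultimately show ?thesis
    by (meson closed_affine_hull closed_sequentially)
qed

section \<open>The dimension of the affine span\<close>

theorem theorem2p3p3:
  fixes idx :: "'m::finite \<Rightarrow> nat"
  assumes "bij_betw idx UNIV {0..CARD('n::finite)}"
  shows "aff_dim (affine hull {alpha_vector idx \<Delta> | \<Delta> :: (real ^ 'n) set. int CARD('n) simplex \<Delta>})
           = \<lfloor>(real CARD('n) - 1) / 2\<rfloor>"
proof -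
  let ?d = "CARD('n)" and ?A = "{alpha_vector idx \<Delta> | \<Delta> :: (real ^ 'n) set. int CARD('n) simplex \<Delta>}"
  let ?q = "limit_alpha_vector idx ?d"
  define m where "m = (?d + 1) div 2"
  have d: "?d \<ge> 1" by (simp add: Suc_le_eq)
  have idx: "idx j \<le> ?d" for j
    using bij_betwE[OF assms] by auto
  have "?q ` {1..?d} \<subseteq> ?q ` {1..m}"
  proof clarify
    fix k assume k: "k \<in> {1..?d}"
    show "?q k \<in> ?q ` {1..m}"
    proof (cases "k \<le> m")
      case False
      \<comment> \<open>The flip symmetry identifies every index beyond \<open>m\<close> with one in
        \<open>{1..m}\<close>.\<close>
      have "?q k = ?q (?d + 1 - k)"
        using k by (simp only: limit_alpha_vector_def) (simp add: symmetric_choose_flip)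
      moreover have "?d + 1 - k \<in> {1..m}" using False k unfolding m_def by auto
      ultimately show ?thesis by simp
    qed (use k in auto)
  qed
  moreover have "?q ` {1..m} \<subseteq> ?q ` {1..?d}"
    unfolding m_def using d by (intro image_mono) auto
  ultimately have qm: "?q ` {1..?d} = ?q ` {1..m}" by blast
  have "?A \<subseteq> affine hull (?q ` {1..?d})"
  proof clarify
    fix \<Delta> :: "(real ^ 'n) set" assume "int ?d simplex \<Delta>"
    then obtain C a b where "barycentric_frame C (\<lambda>v. v) a b" "\<Delta> = convex hull ((\<lambda>v. v) ` C)"
      using simplex_barycentric_frame[of \<Delta>] by auto
    then have "alpha_vector idx \<Delta> \<in> convex hull (?q ` {1..?d})"
      using barycentric_frame.alpha_vector_in_convex_hull[of C "\<lambda>v. v" a b idx] idx by simp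
    then show "alpha_vector idx \<Delta> \<in> affine hull (?q ` {1..?d})"
      using convex_hull_subset_affine_hull by blast
  qed
  moreover have "?q ` {1..?d} \<subseteq> affine hull ?A"
    using limit_alpha_vector_in_affine_hull[where idx = idx and 'n = 'n] idx by blast
  \<comment> \<open>Each of the two generating sets lies in the affine hull of the other.\<close>
  ultimately have "affine hull ?A = affine hull (?q ` {1..m})"
    unfolding qm by (intro equalityI hull_minimal affine_affine_hull)
  then have "aff_dim (affine hull ?A) = aff_dim (?q ` {1..m})" by simp
  \<comment> \<open>Linearly independent vectors are affinely independent, and \<open>m\<close>
    affinely independent points span dimension \<open>m - 1\<close>.\<close>
  also have "\<dots> = int m - 1"
  proof -
    have "\<not> affine_dependent (?q ` {1..m})" and "card (?q ` {1..m}) = m"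
      using independent_limit_alpha_vectors[OF assms] affine_dependent_imp_dependent
      unfolding m_def[symmetric] by (auto simp: card_image)
    then show ?thesis using aff_dim_affine_independent[of "?q ` {1..m}"] by simp
  qed
  also have "\<dots> = \<lfloor>(real ?d - 1) / 2\<rfloor>"
  proof -
    have "2 * m \<le> ?d + 1" "?d + 1 < 2 * m + 2" unfolding m_def by auto
    then show ?thesis by (intro floor_unique[symmetric]) auto
  qed
  finally show ?thesis .
qed

end
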